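(* Let $\mathcal F$ be a function space on a finite partially ordered set $\mathfrak T$, with corresponding global function space $\mathcal F(\mathcal T)$. Assume that for every $F\in\mathfrak T$ we have chosen a subspace $\mathring{\mathcal F}(F)^\dagger$ of $\mathcal F(F)^*$ that is mapped isomorphically onto $\mathring{\mathcal F}(F)^*$ by restriction of functionals to $\mathring{\mathcal F}(F)$, and assume that we have local extension operators $E_F^{\mathcal T}\colon\mathring{\mathcal F}(F)\to\mathcal F(\mathcal T)$ for every $F\in\mathfrak T$. Then, for every $T\in\mathfrak T$, $\mathcal F(T)^*$ is the (internal) direct sum $$\mathcal F(T)^*=\bigoplus_{F\le T}\left(\operatorname{tr}^{T}_F\right)^*\mathring{\mathcal F}(F)^\dagger.$$
   Context: All vector spaces are over a fixed field; $V^*$ is the space of linear functionals on $V$, and for a linear map $A\colon V\to W$ the dual map $A^*\colon W^*\to V^*$ is $A^*\alpha=\alpha\circ A$. A function space $\mathcal F$ on a partially ordered set $\mathfrak T$ consists of a vector space $\mathcal F(F)$ for every $F\in\mathfrak T$ and a linear map $\operatorname{tr}^F_K\colon\mathcal F(F)\to\mathcal F(K)$ (trace map) for every relation $K\le F$, such that $\operatorname{tr}^F_F$ is the identity and $\operatorname{tr}^G_K\circ\operatorname{tr}^F_G=\operatorname{tr}^F_K$ whenever $K\le G\le F$. The subspace of vanishing trace is $\mathring{\mathcal F}(F)=\{\phi\in\mathcal F(F)\mid\operatorname{tr}^F_K\phi=0\text{ for all }K<F\}$. The global function space is $$\mathcal F(\mathcal T)=\Big\{(\phi_F)_{F\in\mathfrak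 T}\in\prod_{F\in\mathfrak T}\mathcal F(F)\;\Big|\;\operatorname{tr}^F_K\phi_F=\phi_K\text{ for all }K\le F\Big\}$$ (here $\mathcal T$ is merely a symbol, distinct from elements $T\in\mathfrak T$), with $\operatorname{tr}^{\mathcal T}_F\colon\mathcal F(\mathcal T)\to\mathcal F(F)$ the natural projections. For $K\in\mathfrak T$, a local extension operator is a linear map $E^{\mathcal T}_K\colon\mathring{\mathcal F}(K)\to\mathcal F(\mathcal T)$ such that $\operatorname{tr}^{\mathcal T}_KE^{\mathcal T}_K\colon\mathring{\mathcal F}(K)\to\mathcal F(K)$ is the inclusion and $\operatorname{tr}^{\mathcal T}_FE^{\mathcal T}_K=0$ for all $F\in\mathfrak T$ with $K\not\le F$. The condition on $\mathring{\mathcal F}(F)^\dagger\subseteq\mathcal F(F)^*$ means explicitly: for every $\alpha\in\mathring{\mathcal F}(F)^*$ there exists $\beta\in\mathring{\mathcal F}(F)^\dagger$ with $\beta(\phi)=\alpha(\phi)$ for all $\phi\in\mathring{\mathcal F}(F)$; and if $\beta\in\mathring{\mathcal F}(F)^\dagger$ satisfies $\beta(\phi)=0$ for all $\phi\in\mathring{\mathcal F}(F)$, then $\beta=0$. *)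

theory Defs
  imports "HOL-Algebra.Module"
begin

text \<open>A vector space over a field \<open>R\<close> is a \<open>module R M\<close>. A linear map is constrained only on the
  carrier of its domain. In the module records defined below, the ring components \<open>mult\<close> and
  \<open>one\<close> carry no meaning.\<close>

definition linear_maps ::
  "('k, 'r) ring_scheme \<Rightarrow> ('k, 'v, 'm) module_scheme \<Rightarrow> ('k, 'w, 'n) module_scheme \<Rightarrow> ('v \<Rightarrow> 'w) set"
  where "linear_maps R M N = {f \<in> carrier M \<rightarrow> carrier N.
    (\<forall>x\<in>carrier M. \<forall>y\<in>carrier M. f (x \<oplus>\<^bsub>M\<^esub> y) = f x \<oplus>\<^bsub>N\<^esub> f y) \<and>
    (\<forall>a\<in>carrier R. \<forall>x\<in>carrier M. f (a \<odot>\<^bsub>M\<^esub> x) = a \<odot>\<^bsub>N\<^esub> f x)}"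

definition field_module :: "('k, 'r) ring_scheme \<Rightarrow> ('k, 'k) module"
  where "field_module R = \<lparr>carrier = carrier R, mult = mult R, one = one R,
    zero = zero R, add = add R, smult = mult R\<rparr>"

text \<open>Functionals are made extensional, so that two functionals on \<open>V\<close> are equal as HOL functions
  iff they agree on the carrier of \<open>V\<close>.\<close>

definition dual_space ::
  "('k, 'r) ring_scheme \<Rightarrow> ('k, 'v, 'm) module_scheme \<Rightarrow> ('k, 'v \<Rightarrow> 'k) module"
  where "dual_space R V = \<lparr>
    carrier = linear_maps R V (field_module R) \<inter> extensional (carrier V),
    mult = undefined, one = undefined,
    zero = (\<lambda>x\<in>carrier V. \<zero>\<^bsub>R\<^esub>),
    add = (\<lambda>\<alpha> \<beta>. \<lambda>x\<in>carrier V. \<alpha> x \<oplus>\<^bsub>R\<^esub> \<beta> x),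
    smult = (\<lambda>a \<alpha>. \<lambda>x\<in>carrier V. a \<otimes>\<^bsub>R\<^esub> \<alpha> x)\<rparr>"

definition dual_map ::
  "('k, 'v, 'm) module_scheme \<Rightarrow> ('v \<Rightarrow> 'w) \<Rightarrow> ('w \<Rightarrow> 'k) \<Rightarrow> 'v \<Rightarrow> 'k"
  where "dual_map V A \<alpha> = compose (carrier V) \<alpha> A"

locale function_space = field R
  for R :: "('k, 'r) ring_scheme" (structure) +
  fixes \<F> :: "'p::order \<Rightarrow> ('k, 'v, 'm) module_scheme"
    and tr :: "'p \<Rightarrow> 'p \<Rightarrow> 'v \<Rightarrow> 'v"
  assumes vector_space: "module R (\<F> F)"
    and tr_linear: "K \<le> F \<Longrightarrow> tr F K \<in> linear_maps R (\<F> F) (\<F> K)"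
    and tr_id: "\<phi> \<in> carrier (\<F> F) \<Longrightarrow> tr F F \<phi> = \<phi>"
    and tr_comp: "K \<le> G \<Longrightarrow> G \<le> F \<Longrightarrow> \<phi> \<in> carrier (\<F> F) \<Longrightarrow> tr G K (tr F G \<phi>) = tr F K \<phi>"

definition vanishing_trace ::
  "('p::order \<Rightarrow> ('k, 'v, 'm) module_scheme) \<Rightarrow> ('p \<Rightarrow> 'p \<Rightarrow> 'v \<Rightarrow> 'v) \<Rightarrow> 'p \<Rightarrow> ('k, 'v, 'm) module_scheme"
  where "vanishing_trace \<F> tr F =
    (\<F> F)\<lparr>carrier := {\<phi> \<in> carrier (\<F> F). \<forall>K<F. tr F K \<phi> = \<zero>\<^bsub>\<F> K\<^esub>}\<rparr>"

definition global_space ::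
  "('p::order \<Rightarrow> ('k, 'v, 'm) module_scheme) \<Rightarrow> ('p \<Rightarrow> 'p \<Rightarrow> 'v \<Rightarrow> 'v) \<Rightarrow> ('k, 'p \<Rightarrow> 'v) module"
  where "global_space \<F> tr = \<lparr>
    carrier = {\<phi> \<in> (\<Pi> F\<in>UNIV. carrier (\<F> F)). \<forall>F K. K \<le> F \<longrightarrow> tr F K (\<phi> F) = \<phi> K},
    mult = undefined, one = undefined,
    zero = (\<lambda>F. \<zero>\<^bsub>\<F> F\<^esub>),
    add = (\<lambda>\<phi> \<psi> F. \<phi> F \<oplus>\<^bsub>\<F> F\<^esub> \<psi> F),
    smult = (\<lambda>a \<phi> F. a \<odot>\<^bsub>\<F> F\<^esub> \<phi> F)\<rparr>"

definition global_tr :: "'p \<Rightarrow> ('p \<Rightarrow> 'v) \<Rightarrow> 'v"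
  where "global_tr F \<phi> = \<phi> F"

definition local_extension_operator ::
  "('k, 'r) ring_scheme \<Rightarrow> ('p::order \<Rightarrow> ('k, 'v, 'm) module_scheme) \<Rightarrow> ('p \<Rightarrow> 'p \<Rightarrow> 'v \<Rightarrow> 'v) \<Rightarrow>
    'p \<Rightarrow> ('v \<Rightarrow> 'p \<Rightarrow> 'v) \<Rightarrow> bool"
  where "local_extension_operator R \<F> tr K E \<longleftrightarrow>
    E \<in> linear_maps R (vanishing_trace \<F> tr K) (global_space \<F> tr) \<and>
    (\<forall>\<phi>\<in>carrier (vanishing_trace \<F> tr K). global_tr K (E \<phi>) = \<phi>) \<and>
    (\<forall>F. \<not> K \<le> F \<longrightarrow> (\<forall>\<phi>\<in>carrier (vanishing_trace \<F> tr K). global_tr F (E \<phi>) = \<zero>\<^bsub>\<F> F\<^esub>))"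

text \<open>A set \<open>D\<close> of functionals on \<open>V\<close> is a subspace of the dual of \<open>V\<close> that restriction maps
  isomorphically onto the dual of \<open>W\<close>, where \<open>W\<close> is a subspace of \<open>V\<close>; restriction is linear, so
  this amounts to surjectivity together with a trivial kernel.\<close>

definition restricts_isomorphically ::
  "('k, 'r) ring_scheme \<Rightarrow> ('k, 'v, 'm) module_scheme \<Rightarrow> ('k, 'v, 'n) module_scheme \<Rightarrow> ('v \<Rightarrow> 'k) set \<Rightarrow> bool"
  where "restricts_isomorphically R V W D \<longleftrightarrow>
    submodule D R (dual_space R V) \<and>
    (\<forall>\<alpha>\<in>carrier (dual_space R W). \<exists>\<beta>\<in>D. \<forall>\<phi>\<in>carrier W. \<beta> \<phi> = \<alpha> \<phi>) \<and>
    (\<forall>\<beta>\<in>D. (\<forall>\<phi>\<in>carrier W. \<beta> \<phi> = \<zero>\<^bsub>R\<^esub>) \<longrightarrow> \<beta> = \<zero>\<^bsub>dual_space R V\<^esub>)"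

definition internal_direct_sum ::
  "('k, 'r) ring_scheme \<Rightarrow> ('k, 'v, 'm) module_scheme \<Rightarrow> 'i set \<Rightarrow> ('i \<Rightarrow> 'v set) \<Rightarrow> bool"
  where "internal_direct_sum R M I U \<longleftrightarrow>
    finite I \<and> (\<forall>i\<in>I. submodule (U i) R M) \<and>
    (\<forall>x\<in>carrier M. \<exists>!u. u \<in> (\<Pi>\<^sub>E i\<in>I. U i) \<and> x = (\<Oplus>\<^bsub>M\<^esub>i\<in>I. u i))"

lemma module_dual_space:
  assumes "field R" "module R V"
  shows "module R (dual_space R V)"
proof -
  interpret module R V by fact
  note d = dual_space_def linear_maps_def field_module_def
  show ?thesis
  proof (rule moduleI)
    show "cring R" ..
    show "abelian_group (dual_space R V)"
    proof (rule abelian_groupI)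
      fix \<alpha> assume a: "\<alpha> \<in> carrier (dual_space R V)"
      show "\<exists>\<beta>\<in>carrier (dual_space R V). \<beta> \<oplus>\<^bsub>dual_space R V\<^esub> \<alpha> = \<zero>\<^bsub>dual_space R V\<^esub>"
        by (rule bexI[where x="\<lambda>x\<in>carrier V. \<ominus>\<^bsub>R\<^esub> \<alpha> x"])
          (use a in \<open>auto simp: d R.l_neg R.minus_add R.r_minus Pi_iff intro!: restrict_ext\<close>)
    qed (auto simp: d Pi_iff R.a_ac R.r_distr intro!: restrict_ext extensionalityI[where A="carrier V"])
  qed (auto simp: d Pi_iff R.r_distr R.l_distr R.m_ac intro!: restrict_ext extensionalityI[where A="carrier V"])
qed

lemma (in function_space) module_global_space: "module R (global_space \<F> tr)"
proof -
  have ag: "abelian_group (\<F> F)" for F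
    using vector_space[of F] by (simp add: module_def)
  note am = ag[THEN abelian_group.axioms(1)]
  have add: "tr F K (x \<oplus>\<^bsub>\<F> F\<^esub> y) = tr F K x \<oplus>\<^bsub>\<F> K\<^esub> tr F K y"
    if "K \<le> F" "x \<in> carrier (\<F> F)" "y \<in> carrier (\<F> F)" for F K x y
    using tr_linear[OF that(1)] that(2,3) by (simp add: linear_maps_def)
  have smult: "tr F K (a \<odot>\<^bsub>\<F> F\<^esub> x) = a \<odot>\<^bsub>\<F> K\<^esub> tr F K x"
    if "K \<le> F" "a \<in> carrier R" "x \<in> carrier (\<F> F)" for F K a x
    using tr_linear[OF that(1)] that(2,3) by (simp add: linear_maps_def)
  have zero: "tr F K \<zero>\<^bsub>\<F> F\<^esub> = \<zero>\<^bsub>\<F> K\<^esub>" if "K \<le> F" for F K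
  proof -
    have "\<zero>\<^bsub>\<F> K\<^esub> = \<zero> \<odot>\<^bsub>\<F> K\<^esub> tr F K \<zero>\<^bsub>\<F> F\<^esub>"
      using tr_linear[OF that] module.smult_l_null[OF vector_space[of K]]
      by (simp add: linear_maps_def Pi_iff abelian_monoid.zero_closed[OF am])
    also have "\<dots> = tr F K (\<zero> \<odot>\<^bsub>\<F> F\<^esub> \<zero>\<^bsub>\<F> F\<^esub>)"
      using smult[OF that] by (simp add: abelian_monoid.zero_closed[OF am])
    finally show ?thesis
      using module.smult_l_null[OF vector_space[of F]]
      by (simp add: abelian_monoid.zero_closed[OF am])
  qed
  note closed = abelian_monoid.a_closed[OF am] abelian_monoid.zero_closed[OF am]
    module.smult_closed[OF vector_space]
  show ?thesis
  proof (rule moduleI)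
    show "cring R" ..
    show "abelian_group (global_space \<F> tr)"
    proof (rule abelian_groupI)
      fix \<phi> assume p: "\<phi> \<in> carrier (global_space \<F> tr)"
      show "\<exists>\<psi>\<in>carrier (global_space \<F> tr). \<psi> \<oplus>\<^bsub>global_space \<F> tr\<^esub> \<phi> = \<zero>\<^bsub>global_space \<F> tr\<^esub>"
      proof (rule bexI[where x="\<lambda>F. (\<ominus> \<one>) \<odot>\<^bsub>\<F> F\<^esub> \<phi> F"])
        have "(\<ominus> \<one>) \<odot>\<^bsub>\<F> F\<^esub> \<phi> F = \<ominus>\<^bsub>\<F> F\<^esub> \<phi> F" for F
          using p module.smult_l_minus[OF vector_space[of F], of \<one> "\<phi> F"]
            module.smult_one[OF vector_space[of F], of "\<phi> F"]
          by (simp add: global_space_def Pi_iff)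
        then show "(\<lambda>F. (\<ominus> \<one>) \<odot>\<^bsub>\<F> F\<^esub> \<phi> F) \<oplus>\<^bsub>global_space \<F> tr\<^esub> \<phi> = \<zero>\<^bsub>global_space \<F> tr\<^esub>"
          using p by (simp add: global_space_def Pi_iff abelian_group.l_neg[OF ag])
      qed (use p in \<open>auto simp: global_space_def Pi_iff closed smult\<close>)
    qed (auto simp: global_space_def Pi_iff closed add zero abelian_monoid.a_assoc[OF am]
        abelian_monoid.l_zero[OF am] intro!: abelian_monoid.a_comm[OF am])
  qed (auto simp: global_space_def Pi_iff closed smult module.smult_l_distr[OF vector_space]
      module.smult_r_distr[OF vector_space] module.smult_assoc1[OF vector_space]
      module.smult_one[OF vector_space])
qed

end

theory Submission
  imports Defs
begin

text \<open>
  Every \<open>\<phi>\<close> in \<open>\<F>(T)\<close> is a sum of pieces \<open>tr\<^sub>T (E\<^sub>K \<psi>)\<close> with \<open>K \<le> T\<close> and \<open>\<psi>\<close> of vanishing trace on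
  \<open>K\<close>: if \<open>K\<close> is a minimal element at which the trace of \<open>\<phi>\<close> is nonzero, that trace itself has
  vanishing trace, and subtracting its extension removes \<open>K\<close> from the support of \<open>\<phi>\<close> without adding
  anything new. Hence a functional on \<open>\<F>(T)\<close> is determined by its values on the sets
  \<open>X\<^sub>K = {tr\<^sub>T (E\<^sub>K \<psi>)}\<close> (\<open>functional_vanishing_on_extensions\<close>).

  Against these sets the summands \<open>U\<^sub>F\<close>, the pullbacks of the given functionals on \<open>\<F>(F)\<close>, form a
  triangular system. On \<open>X\<^sub>K\<close> a pullback from \<open>F\<close> sees only the trace of \<open>E\<^sub>K \<psi>\<close> on \<open>F\<close>, which is
  zero unless \<open>K \<le> F\<close>, and for \<open>F = K\<close> is \<open>\<psi>\<close> itself. So the diagonal blocks are the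
  restrictions of functionals on \<open>\<F>(K)\<close> to the subspace of vanishing trace, which are bijective by
  assumption. A triangular system with bijective diagonal blocks is uniquely solvable, by
  substitution from the maximal indices downwards (\<open>internal_direct_sum_if_triangular\<close>).
\<close>

section \<open>Functionals on a vector space\<close>

locale functionals = field R + V: module R V
  for R :: "('k, 'r) ring_scheme" (structure) and V :: "('k, 'v, 'm) module_scheme"
begin

sublocale dual: module R "dual_space R V"
  by (rule module_dual_space) unfold_locales

lemma functional_closed: "\<alpha> \<in> carrier (dual_space R V) \<Longrightarrow> x \<in> carrier V \<Longrightarrow> \<alpha> x \<in> carrier R"
  by (auto simp: dual_space_def linear_maps_def field_module_def)

lemma functional_add:
  "\<alpha> \<in> carrier (dual_space R V) \<Longrightarrow> x \<in> carrier V \<Longrightarrow> y \<in> carrier V \<Longrightarrow> \<alpha> (x \<oplus>\<^bsub>V\<^esub> y) = \<alpha> x \<oplus> \<alpha> y"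
  by (auto simp: dual_space_def linear_maps_def field_module_def)

lemma functional_smult:
  "\<alpha> \<in> carrier (dual_space R V) \<Longrightarrow> a \<in> carrier R \<Longrightarrow> x \<in> carrier V \<Longrightarrow> \<alpha> (a \<odot>\<^bsub>V\<^esub> x) = a \<otimes> \<alpha> x"
  by (auto simp: dual_space_def linear_maps_def field_module_def)

lemma functional_zero: "\<alpha> \<in> carrier (dual_space R V) \<Longrightarrow> \<alpha> \<zero>\<^bsub>V\<^esub> = \<zero>"
  using functional_smult[of \<alpha> \<zero> "\<zero>\<^bsub>V\<^esub>"] by (simp add: functional_closed)

lemma functional_eqI:
  assumes "\<alpha> \<in> carrier (dual_space R V)" "\<beta> \<in> carrier (dual_space R V)"
    and "\<And>x. x \<in> carrier V \<Longrightarrow> \<alpha> x = \<beta> x"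
  shows "\<alpha> = \<beta>"
  using assms by (auto simp: dual_space_def intro: extensionalityI)

lemma dual_add_apply: "x \<in> carrier V \<Longrightarrow> (\<alpha> \<oplus>\<^bsub>dual_space R V\<^esub> \<beta>) x = \<alpha> x \<oplus> \<beta> x"
  by (simp add: dual_space_def)

lemma dual_zero_apply: "x \<in> carrier V \<Longrightarrow> \<zero>\<^bsub>dual_space R V\<^esub> x = \<zero>"
  by (simp add: dual_space_def)

lemma dual_minus_apply:
  assumes "\<alpha> \<in> carrier (dual_space R V)" "\<beta> \<in> carrier (dual_space R V)" "x \<in> carrier V"
  shows "(\<alpha> \<ominus>\<^bsub>dual_space R V\<^esub> \<beta>) x = \<alpha> x \<ominus> \<beta> x"
proof -
  have "(\<ominus>\<^bsub>dual_space R V\<^esub> \<beta>) x \<oplus> \<beta> x = \<zero>"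
    using assms dual_add_apply[of x "\<ominus>\<^bsub>dual_space R V\<^esub> \<beta>" \<beta>]
    by (simp add: dual.l_neg dual_zero_apply)
  then have "(\<ominus>\<^bsub>dual_space R V\<^esub> \<beta>) x = \<ominus> \<beta> x"
    using assms by (simp add: functional_closed minus_equality)
  then show ?thesis
    using assms by (simp add: dual_add_apply a_minus_def)
qed

lemma dual_finsum_apply:
  assumes "finite S" "u \<in> S \<rightarrow> carrier (dual_space R V)" "x \<in> carrier V"
  shows "(\<Oplus>\<^bsub>dual_space R V\<^esub>F\<in>S. u F) x = (\<Oplus>F\<in>S. u F x)"
  using assms
proof (induction S rule: finite_induct)
  case empty
  then show ?case by (simp add: dual_zero_apply)
next
  case (insert F S)
  then show ?case
    by (simp add: dual.finsum_insert finsum_insert dual_add_apply Pi_iff functional_closed)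
qed

lemma submodule_minus_closed:
  assumes "submodule U R (dual_space R V)" "\<alpha> \<in> U" "\<beta> \<in> U"
  shows "\<alpha> \<ominus>\<^bsub>dual_space R V\<^esub> \<beta> \<in> U"
  using dual.submoduleE[OF assms(1)] assms(2,3) by (simp add: a_minus_def)


section \<open>Triangular families of functionals\<close>

text \<open>Substitution in the triangular system: removing a maximal index \<open>K\<close> from a lower set \<open>S\<close> of
  unsolved indices costs one correction by an element of \<open>U K\<close>, and triangularity confines the
  effect of that correction to indices below \<open>K\<close>, which all remain in \<open>S\<close>.\<close>

lemma triangular_sum_exists:
  fixes I :: "'i::order set"
  assumes "finite I" and U: "\<And>F. F \<in> I \<Longrightarrow> submodule (U F) R (dual_space R V)"
    and X: "\<And>K. K \<in> I \<Longrightarrow> X K \<subseteq> carrier V"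
    and triangular: "\<And>F K u x. \<lbrakk>F \<in> I; K \<in> I; \<not> K \<le> F; u \<in> U F; x \<in> X K\<rbrakk> \<Longrightarrow> u x = \<zero>"
    and diagonal_surj: "\<And>K \<alpha>. K \<in> I \<Longrightarrow> \<alpha> \<in> carrier (dual_space R V) \<Longrightarrow>
      \<exists>u\<in>U K. \<forall>x\<in>X K. u x = \<alpha> x"
    and separating: "\<And>\<alpha>. \<alpha> \<in> carrier (dual_space R V) \<Longrightarrow> (\<And>K x. K \<in> I \<Longrightarrow> x \<in> X K \<Longrightarrow> \<alpha> x = \<zero>) \<Longrightarrow>
      \<alpha> = \<zero>\<^bsub>dual_space R V\<^esub>"
    and "S \<subseteq> I" and lower: "\<And>F K. F \<in> S \<Longrightarrow> K \<in> I \<Longrightarrow> K \<le> F \<Longrightarrow> K \<in> S"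
    and "\<alpha> \<in> carrier (dual_space R V)"
    and "\<And>K x. K \<in> I - S \<Longrightarrow> x \<in> X K \<Longrightarrow> \<alpha> x = \<zero>"
  shows "\<exists>u \<in> (\<Pi>\<^sub>E F\<in>S. U F). \<alpha> = (\<Oplus>\<^bsub>dual_space R V\<^esub>F\<in>S. u F)"
proof -
  have "finite S"
    using assms(1,7) finite_subset by blast
  then show ?thesis
    using assms(7-10)
  proof (induction S arbitrary: \<alpha> rule: finite_psubset_induct)
    case (psubset S)
    show ?case
    proof (cases "S = {}")
      case True
      then show ?thesis
        using psubset.prems separating[of \<alpha>] by auto
    next
      case False
      then obtain K where K: "K \<in> S" and max: "\<And>F. F \<in> S \<Longrightarrow> K \<le> F \<Longrightarrow> K = F"
        using finite_has_maximal[OF psubset.hyps] by blast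
      have KI: "K \<in> I"
        using K psubset.prems(1) by blast
      obtain v where v: "v \<in> U K" "\<And>x. x \<in> X K \<Longrightarrow> v x = \<alpha> x"
        using diagonal_surj[OF KI psubset.prems(3)] by blast
      have vc: "v \<in> carrier (dual_space R V)"
        using dual.submoduleE(1)[OF U[OF KI]] v(1) by blast
      let ?\<alpha> = "\<alpha> \<ominus>\<^bsub>dual_space R V\<^esub> v"
      \<comment> \<open>If \<open>L\<close> is outside \<open>S\<close>, then \<open>v\<close> vanishes on \<open>X L\<close>: otherwise \<open>L \<le> K\<close>, and \<open>L\<close> would lie in the lower set \<open>S\<close>.\<close>
      have "\<exists>u \<in> (\<Pi>\<^sub>E F\<in>S - {K}. U F). ?\<alpha> = (\<Oplus>\<^bsub>dual_space R V\<^esub>F\<in>S - {K}. u F)"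
      proof (rule psubset.IH)
        show "L \<in> S - {K}" if "F \<in> S - {K}" "L \<in> I" "L \<le> F" for F L
          using that psubset.prems(2)[of F L] max[of F] by blast
        show "?\<alpha> x = \<zero>" if L: "L \<in> I - (S - {K})" and x: "x \<in> X L" for L x
        proof (cases "L = K")
          case True
          then show ?thesis
            using x v X[OF KI] vc psubset.prems(3)
            by (auto simp: dual_minus_apply functional_closed minus_eq r_neg)
        next
          case False
          then have "v x = \<zero>"
            using L K x triangular[OF KI _ _ v(1)] psubset.prems(2)[of K L] by blast
          moreover have "\<alpha> x = \<zero>"
            using False L x psubset.prems(4) by blast
          ultimately show ?thesis
            using L x X[of L] vc psubset.prems(3) by (auto simp: dual_minus_apply minus_eq)
        qed
      qed (use K vc psubset.prems in auto)
      then obtain u where u: "u \<in> (\<Pi>\<^sub>E F\<in>S - {K}. U F)"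
        and sum: "?\<alpha> = (\<Oplus>\<^bsub>dual_space R V\<^esub>F\<in>S - {K}. u F)" by blast
      have uc: "u \<in> S - {K} \<rightarrow> carrier (dual_space R V)"
        using u dual.submoduleE(1)[OF U] psubset.prems(1) by (fastforce simp: PiE_iff)
      let ?u = "u(K := v)"
      have "(\<Oplus>\<^bsub>dual_space R V\<^esub>F\<in>S. ?u F) = (\<Oplus>\<^bsub>dual_space R V\<^esub>F\<in>insert K (S - {K}). ?u F)"
        using K by (simp add: insert_absorb)
      also have "\<dots> = v \<oplus>\<^bsub>dual_space R V\<^esub> (\<Oplus>\<^bsub>dual_space R V\<^esub>F\<in>S - {K}. ?u F)"
        using uc vc psubset.hyps by (subst dual.finsum_insert) auto
      also have "(\<Oplus>\<^bsub>dual_space R V\<^esub>F\<in>S - {K}. ?u F) = ?\<alpha>"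
        unfolding sum using uc by (intro dual.finsum_cong') auto
      also have "v \<oplus>\<^bsub>dual_space R V\<^esub> ?\<alpha> = \<alpha>"
        using vc psubset.prems(3) by (simp add: a_minus_def dual.a_lcomm dual.r_neg)
      finally have "\<alpha> = (\<Oplus>\<^bsub>dual_space R V\<^esub>F\<in>S. ?u F)" ..
      moreover have "?u \<in> (\<Pi>\<^sub>E F\<in>S. U F)"
        using u v(1) K by (auto simp: PiE_iff extensional_def)
      ultimately show ?thesis by blast
    qed
  qed
qed

text \<open>At a maximal index \<open>K\<close> where two families with the same sum differ, evaluation on \<open>X K\<close>
  cannot distinguish the other summands: those above \<open>K\<close> agree and the rest vanish there. So
  the \<open>K\<close>-th summands agree on \<open>X K\<close>, hence coincide.\<close>

lemma triangular_sum_unique: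
  fixes I :: "'i::order set"
  assumes "finite I" and U: "\<And>F. F \<in> I \<Longrightarrow> submodule (U F) R (dual_space R V)"
    and X: "\<And>K. K \<in> I \<Longrightarrow> X K \<subseteq> carrier V"
    and triangular: "\<And>F K u x. \<lbrakk>F \<in> I; K \<in> I; \<not> K \<le> F; u \<in> U F; x \<in> X K\<rbrakk> \<Longrightarrow> u x = \<zero>"
    and diagonal_inj: "\<And>K u. K \<in> I \<Longrightarrow> u \<in> U K \<Longrightarrow> (\<And>x. x \<in> X K \<Longrightarrow> u x = \<zero>) \<Longrightarrow>
      u = \<zero>\<^bsub>dual_space R V\<^esub>"
    and u: "u \<in> (\<Pi>\<^sub>E F\<in>I. U F)" and v: "v \<in> (\<Pi>\<^sub>E F\<in>I. U F)"
    and sum: "(\<Oplus>\<^bsub>dual_space R V\<^esub>F\<in>I. u F) = (\<Oplus>\<^bsub>dual_space R V\<^esub>F\<in>I. v F)"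
  shows "u = v"
proof (rule ccontr)
  assume "u \<noteq> v"
  define S where "S = {F \<in> I. u F \<noteq> v F}"
  have "\<not> (\<forall>F\<in>I. u F = v F)"
    using \<open>u \<noteq> v\<close> PiE_ext[OF u v] by meson
  then have "S \<noteq> {}"
    unfolding S_def by blast
  moreover have "finite S"
    using \<open>finite I\<close> by (simp add: S_def)
  ultimately obtain K where K: "K \<in> S" "\<forall>F\<in>S. K \<le> F \<longrightarrow> K = F"
    using finite_has_maximal[of S] by blast
  then have KI: "K \<in> I" and ne: "u K \<noteq> v K"
    and max: "\<And>F. F \<in> I \<Longrightarrow> K \<le> F \<Longrightarrow> F \<noteq> K \<Longrightarrow> u F = v F"
    unfolding S_def by blast+
  have uc: "u \<in> I \<rightarrow> carrier (dual_space R V)" and vc: "v \<in> I \<rightarrow> carrier (dual_space R V)"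
    using u v dual.submoduleE(1)[OF U] by (fastforce simp: PiE_iff)+
  have agree: "u K x = v K x" if x: "x \<in> X K" for x
  proof -
    have xV: "x \<in> carrier V"
      using x X[OF KI] by blast
    have split: "(\<Oplus>\<^bsub>dual_space R V\<^esub>F\<in>I. w F) x = w K x \<oplus> (\<Oplus>F\<in>I - {K}. w F x)"
      if "w \<in> I \<rightarrow> carrier (dual_space R V)" for w
    proof -
      have "(\<Oplus>F\<in>I. w F x) = (\<Oplus>F\<in>insert K (I - {K}). w F x)"
        using KI by (simp add: insert_absorb)
      also have "\<dots> = w K x \<oplus> (\<Oplus>F\<in>I - {K}. w F x)"
        using that KI xV \<open>finite I\<close> by (subst finsum_insert) (auto simp: functional_closed Pi_iff)
      finally show ?thesis
        using that xV \<open>finite I\<close> by (simp add: dual_finsum_apply)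
    qed
    have rest: "(\<Oplus>F\<in>I - {K}. u F x) = (\<Oplus>F\<in>I - {K}. v F x)"
    proof (rule finsum_cong')
      show "u F x = v F x" if F: "F \<in> I - {K}" for F
      proof (cases "K \<le> F")
        case True
        then show ?thesis using F max by simp
      next
        case False
        then have "u F x = \<zero>" "v F x = \<zero>"
          using F KI x triangular[of F K _ x] PiE_mem[OF u] PiE_mem[OF v] by simp_all
        then show ?thesis by simp
      qed
    qed (use vc xV in \<open>auto simp: functional_closed Pi_iff\<close>)
    have "(\<Oplus>F\<in>I - {K}. v F x) \<in> carrier R"
      using vc xV by (intro finsum_closed) (auto simp: functional_closed Pi_iff)
    moreover have "u K x \<in> carrier R" "v K x \<in> carrier R"
      using uc vc xV KI by (simp_all add: functional_closed Pi_iff)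
    moreover have "u K x \<oplus> (\<Oplus>F\<in>I - {K}. v F x) = v K x \<oplus> (\<Oplus>F\<in>I - {K}. v F x)"
      using split[OF uc] split[OF vc] rest sum by simp
    ultimately show ?thesis
      by (simp add: add.right_cancel)
  qed
  have "u K \<ominus>\<^bsub>dual_space R V\<^esub> v K = \<zero>\<^bsub>dual_space R V\<^esub>"
  proof (rule diagonal_inj[OF KI])
    show "u K \<ominus>\<^bsub>dual_space R V\<^esub> v K \<in> U K"
      using u v KI by (intro submodule_minus_closed U) auto
    show "(u K \<ominus>\<^bsub>dual_space R V\<^esub> v K) x = \<zero>" if x: "x \<in> X K" for x
    proof -
      have "x \<in> carrier V"
        using x X[OF KI] by blast
      then show ?thesis
        using agree[OF x] uc vc KI
        by (simp add: Pi_iff dual_minus_apply functional_closed minus_eq r_neg)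
    qed
  qed
  then have "u K = v K"
    using uc vc KI dual.minus_equality[of "u K" "\<ominus>\<^bsub>dual_space R V\<^esub> v K"]
    by (simp add: Pi_iff a_minus_def dual.minus_minus)
  then show False
    using ne by simp
qed

text \<open>The values of the summands on the test sets \<open>X K\<close> form a block triangular matrix. Invertible
  diagonal blocks make a functional's values on the test sets uniquely solvable for the summands,
  and the test sets separate functionals, so a solution there is a decomposition.\<close>

lemma internal_direct_sum_if_triangular:
  fixes I :: "'i::order set"
  assumes "finite I" and "\<And>F. F \<in> I \<Longrightarrow> submodule (U F) R (dual_space R V)"
    and "\<And>K. K \<in> I \<Longrightarrow> X K \<subseteq> carrier V"
    and "\<And>F K u x. \<lbrakk>F \<in> I; K \<in> I; \<not> K \<le> F; u \<in> U F; x \<in> X K\<rbrakk> \<Longrightarrow> u x = \<zero>"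
    and "\<And>K \<alpha>. K \<in> I \<Longrightarrow> \<alpha> \<in> carrier (dual_space R V) \<Longrightarrow> \<exists>u\<in>U K. \<forall>x\<in>X K. u x = \<alpha> x"
    and "\<And>K u. K \<in> I \<Longrightarrow> u \<in> U K \<Longrightarrow> (\<And>x. x \<in> X K \<Longrightarrow> u x = \<zero>) \<Longrightarrow> u = \<zero>\<^bsub>dual_space R V\<^esub>"
    and "\<And>\<alpha>. \<alpha> \<in> carrier (dual_space R V) \<Longrightarrow> (\<And>K x. K \<in> I \<Longrightarrow> x \<in> X K \<Longrightarrow> \<alpha> x = \<zero>) \<Longrightarrow>
      \<alpha> = \<zero>\<^bsub>dual_space R V\<^esub>"
  shows "internal_direct_sum R (dual_space R V) I U"
proof -
  have "\<exists>!u. u \<in> (\<Pi>\<^sub>E F\<in>I. U F) \<and> \<alpha> = (\<Oplus>\<^bsub>dual_space R V\<^esub>F\<in>I. u F)"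
    if \<alpha>: "\<alpha> \<in> carrier (dual_space R V)" for \<alpha>
  proof (rule ex_ex1I)
    have "\<exists>u \<in> (\<Pi>\<^sub>E F\<in>I. U F). \<alpha> = (\<Oplus>\<^bsub>dual_space R V\<^esub>F\<in>I. u F)"
      by (rule triangular_sum_exists[where I = I and X = X]) (use assms \<alpha> in auto)
    then show "\<exists>u. u \<in> (\<Pi>\<^sub>E F\<in>I. U F) \<and> \<alpha> = (\<Oplus>\<^bsub>dual_space R V\<^esub>F\<in>I. u F)" by blast
    show "u = v" if "u \<in> (\<Pi>\<^sub>E F\<in>I. U F) \<and> \<alpha> = (\<Oplus>\<^bsub>dual_space R V\<^esub>F\<in>I. u F)"
      "v \<in> (\<Pi>\<^sub>E F\<in>I. U F) \<and> \<alpha> = (\<Oplus>\<^bsub>dual_space R V\<^esub>F\<in>I. v F)" for u v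
      by (rule triangular_sum_unique[where I = I and X = X and U = U]) (use assms that in auto)
  qed
  then show ?thesis
    using assms(1,2) by (simp add: internal_direct_sum_def)
qed

end


section \<open>Pullback of functionals\<close>

lemma dual_map_apply: "x \<in> carrier V \<Longrightarrow> dual_map V A \<alpha> x = \<alpha> (A x)"
  by (simp add: dual_map_def compose_def)

lemma dual_map_linear:
  assumes "field R" "module R V" "module R W" and A: "A \<in> linear_maps R V W"
  shows "dual_map V A \<in> linear_maps R (dual_space R W) (dual_space R V)"
proof -
  interpret V: functionals R V
    using assms(1,2) by (simp add: functionals_def)
  interpret W: functionals R W
    using assms(1,3) by (simp add: functionals_def)
  show ?thesis
    using A
    by (auto simp: linear_maps_def dual_space_def field_module_def dual_map_def compose_def Pi_iff
        intro!: restrict_ext)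
qed

lemma linear_image_submodule:
  assumes M: "module R M" and N: "module R N" and f: "f \<in> linear_maps R M N"
    and D: "submodule D R M"
  shows "submodule (f ` D) R N"
proof -
  interpret M: module R M by fact
  interpret N: module R N by fact
  note DE = M.submoduleE[OF D]
  have fc: "f x \<in> carrier N" if "x \<in> D" for x
    using f that DE(1) by (auto simp: linear_maps_def)
  have fadd: "f (x \<oplus>\<^bsub>M\<^esub> y) = f x \<oplus>\<^bsub>N\<^esub> f y" if "x \<in> D" "y \<in> D" for x y
    using f that DE(1) by (simp add: linear_maps_def subset_iff)
  have fsmult: "f (a \<odot>\<^bsub>M\<^esub> x) = a \<odot>\<^bsub>N\<^esub> f x" if "a \<in> carrier R" "x \<in> D" for a x
    using f that DE(1) by (auto simp: linear_maps_def)
  have minus: "\<ominus>\<^bsub>N\<^esub> f x \<in> f ` D" if x: "x \<in> D" for x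
  proof -
    have "\<ominus>\<^bsub>N\<^esub> f x = (\<ominus>\<^bsub>R\<^esub> \<one>\<^bsub>R\<^esub>) \<odot>\<^bsub>N\<^esub> f x"
      using fc[OF x] by (simp add: N.smult_l_minus)
    then have "\<ominus>\<^bsub>N\<^esub> f x = f ((\<ominus>\<^bsub>R\<^esub> \<one>\<^bsub>R\<^esub>) \<odot>\<^bsub>M\<^esub> x)"
      using x by (simp add: fsmult)
    then show ?thesis
      using DE(4)[of "\<ominus>\<^bsub>R\<^esub> \<one>\<^bsub>R\<^esub>" x] x by simp
  qed
  show ?thesis
  proof (rule N.submoduleI)
    obtain x where x: "x \<in> D"
      using DE(2) by blast
    then have "\<zero>\<^bsub>N\<^esub> = f (\<zero>\<^bsub>R\<^esub> \<odot>\<^bsub>M\<^esub> x)"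
      by (simp add: fsmult fc)
    then show "\<zero>\<^bsub>N\<^esub> \<in> f ` D"
      using DE(4)[of "\<zero>\<^bsub>R\<^esub>" x] x by simp
  next
    fix a b assume "a \<in> f ` D" "b \<in> f ` D"
    then show "a \<oplus>\<^bsub>N\<^esub> b \<in> f ` D"
      using DE(5) fadd by (force simp: image_iff)
  next
    fix a y assume "a \<in> carrier R" "y \<in> f ` D"
    then show "a \<odot>\<^bsub>N\<^esub> y \<in> f ` D"
      using DE(4) fsmult by (force simp: image_iff)
  qed (use fc minus in auto)
qed


section \<open>Local extensions span\<close>

context function_space
begin

lemma functionals_local: "functionals R (\<F> F)"
  by (intro functionals.intro vector_space) unfold_locales

lemma tr_closed: "K \<le> F \<Longrightarrow> \<phi> \<in> carrier (\<F> F) \<Longrightarrow> tr F K \<phi> \<in> carrier (\<F> K)"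
  using tr_linear[of K F] by (auto simp: linear_maps_def)

lemma tr_diff:
  assumes "K \<le> F" "\<phi> \<in> carrier (\<F> F)" "\<psi> \<in> carrier (\<F> F)"
  shows "tr F K (\<phi> \<ominus>\<^bsub>\<F> F\<^esub> \<psi>) = tr F K \<phi> \<ominus>\<^bsub>\<F> K\<^esub> tr F K \<psi>"
proof -
  interpret F: module R "\<F> F" by (rule vector_space)
  interpret K: module R "\<F> K" by (rule vector_space)
  have "tr F K ((\<phi> \<ominus>\<^bsub>\<F> F\<^esub> \<psi>) \<oplus>\<^bsub>\<F> F\<^esub> \<psi>) = tr F K (\<phi> \<ominus>\<^bsub>\<F> F\<^esub> \<psi>) \<oplus>\<^bsub>\<F> K\<^esub> tr F K \<psi>"
    using tr_linear[OF assms(1)] assms(2,3) by (simp add: linear_maps_def)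
  then show ?thesis
    using assms by (simp add: tr_closed a_minus_def F.a_assoc F.l_neg K.a_assoc K.r_neg)
qed

lemma tr_zero: "K \<le> F \<Longrightarrow> tr F K \<zero>\<^bsub>\<F> F\<^esub> = \<zero>\<^bsub>\<F> K\<^esub>"
proof -
  assume "K \<le> F"
  interpret F: module R "\<F> F" by (rule vector_space)
  interpret K: module R "\<F> K" by (rule vector_space)
  show ?thesis
    using tr_diff[OF \<open>K \<le> F\<close>, of "\<zero>\<^bsub>\<F> F\<^esub>" "\<zero>\<^bsub>\<F> F\<^esub>"] tr_closed[OF \<open>K \<le> F\<close>, of "\<zero>\<^bsub>\<F> F\<^esub>"]
    by (simp add: a_minus_def F.r_neg K.r_neg)
qed

lemma extension_closed:
  assumes "local_extension_operator R \<F> tr K E" "\<psi> \<in> carrier (vanishing_trace \<F> tr K)"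
  shows "E \<psi> F \<in> carrier (\<F> F)"
  using assms by (auto simp: local_extension_operator_def linear_maps_def global_space_def Pi_iff)

lemma tr_extension:
  assumes "local_extension_operator R \<F> tr K E" "\<psi> \<in> carrier (vanishing_trace \<F> tr K)" "F \<le> G"
  shows "tr G F (E \<psi> G) = E \<psi> F"
  using assms by (auto simp: local_extension_operator_def linear_maps_def global_space_def Pi_iff)

lemma extension_self:
  assumes "local_extension_operator R \<F> tr K E" "\<psi> \<in> carrier (vanishing_trace \<F> tr K)"
  shows "E \<psi> K = \<psi>"
  using assms by (auto simp: local_extension_operator_def global_tr_def)

lemma extension_eq_zero:
  assumes "local_extension_operator R \<F> tr K E" "\<psi> \<in> carrier (vanishing_trace \<F> tr K)" "\<not> K \<le> F"
  shows "E \<psi> F = \<zero>\<^bsub>\<F> F\<^esub>"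
  using assms by (auto simp: local_extension_operator_def global_tr_def)

text \<open>By transitivity of traces the support \<open>{K. K \<le> T \<and> tr T K \<phi> \<noteq> 0}\<close> is closed upwards below
  \<open>T\<close>. The extension from a minimal element \<open>K\<close> of the support lives on elements above \<open>K\<close>, so
  subtracting it cannot enlarge the support, while it removes \<open>K\<close>. When the support is empty,
  \<open>\<phi> = tr T T \<phi> = 0\<close>.\<close>

lemma functional_vanishing_on_extensions:
  assumes fin: "finite {F. F \<le> T}" and E: "\<And>K. K \<le> T \<Longrightarrow> local_extension_operator R \<F> tr K (E K)"
    and \<alpha>: "\<alpha> \<in> carrier (dual_space R (\<F> T))"
    and vanish: "\<And>K \<psi>. K \<le> T \<Longrightarrow> \<psi> \<in> carrier (vanishing_trace \<F> tr K) \<Longrightarrow> \<alpha> (E K \<psi> T) = \<zero>"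
  shows "\<alpha> = \<zero>\<^bsub>dual_space R (\<F> T)\<^esub>"
proof -
  interpret T: functionals R "\<F> T" by (rule functionals_local)
  define supp where "supp \<phi> = {K. K \<le> T \<and> tr T K \<phi> \<noteq> \<zero>\<^bsub>\<F> K\<^esub>}" for \<phi>
  have fin_supp: "finite (supp \<phi>)" for \<phi>
    using fin by (rule rev_finite_subset) (auto simp: supp_def)
  have "\<alpha> \<phi> = \<zero>" if "\<phi> \<in> carrier (\<F> T)" for \<phi>
    using that
  proof (induction "card (supp \<phi>)" arbitrary: \<phi> rule: less_induct)
    case less
    show ?case
    proof (cases "supp \<phi> = {}")
      case True
      then have "\<phi> = \<zero>\<^bsub>\<F> T\<^esub>"
        using tr_id[OF less.prems] by (auto simp: supp_def)
      then show ?thesis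
        using T.functional_zero[OF \<alpha>] by simp
    next
      case False
      then obtain K where K: "K \<in> supp \<phi>" and min: "\<And>F. F \<in> supp \<phi> \<Longrightarrow> F \<le> K \<Longrightarrow> K = F"
        using finite_has_minimal[OF fin_supp] by blast
      then have KT: "K \<le> T" by (simp add: supp_def)
      let ?\<psi> = "tr T K \<phi>"
      have \<psi>: "?\<psi> \<in> carrier (vanishing_trace \<F> tr K)"
      proof -
        have "tr K L ?\<psi> = \<zero>\<^bsub>\<F> L\<^esub>" if "L < K" for L
        proof -
          have "L \<notin> supp \<phi>"
            using min[of L] that less_imp_le[OF that] by blast
          then show ?thesis
            using that KT less.prems tr_comp[of L K T \<phi>] by (simp add: supp_def)
        qed
        then show ?thesis
          using tr_closed[OF KT less.prems] by (simp add: vanishing_trace_def)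
      qed
      let ?x = "E K ?\<psi> T"
      have x: "?x \<in> carrier (\<F> T)"
        using extension_closed[OF E[OF KT] \<psi>] .
      let ?\<phi> = "\<phi> \<ominus>\<^bsub>\<F> T\<^esub> ?x"
      have tr': "tr T F ?\<phi> = tr T F \<phi> \<ominus>\<^bsub>\<F> F\<^esub> E K ?\<psi> F" if "F \<le> T" for F
        using that less.prems x by (simp add: tr_diff tr_extension[OF E[OF KT] \<psi>])
      have "K \<notin> supp ?\<phi>"
      proof -
        interpret K: module R "\<F> K" by (rule vector_space)
        show ?thesis
          using tr'[OF KT] extension_self[OF E[OF KT] \<psi>] tr_closed[OF KT less.prems]
          by (simp add: supp_def a_minus_def K.r_neg)
      qed
      moreover have "F \<notin> supp ?\<phi>" if F: "F \<notin> supp \<phi>" for F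
      proof (cases "F \<le> T")
        case True
        interpret F: module R "\<F> F" by (rule vector_space)
        have trF: "tr T F \<phi> = \<zero>\<^bsub>\<F> F\<^esub>"
          using F True by (simp add: supp_def)
        have "\<not> K \<le> F"
        proof
          assume "K \<le> F"
          then have "tr T K \<phi> = \<zero>\<^bsub>\<F> K\<^esub>"
            using tr_comp[OF _ True less.prems, of K] tr_zero[of K F] trF by simp
          then show False
            using K by (simp add: supp_def)
        qed
        then show ?thesis
          using tr'[OF True] trF extension_eq_zero[OF E[OF KT] \<psi>]
          by (simp add: supp_def a_minus_def)
      qed (simp add: supp_def)
      ultimately have "supp ?\<phi> \<subset> supp \<phi>"
        using K by blast
      then have "\<alpha> ?\<phi> = \<zero>"
        using less.hyps[of ?\<phi>] psubset_card_mono[OF fin_supp] less.prems x by simp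
      moreover have "\<alpha> ?x = \<zero>"
        using vanish[OF KT \<psi>] .
      moreover have "\<phi> = ?\<phi> \<oplus>\<^bsub>\<F> T\<^esub> ?x"
        using less.prems x by (simp add: a_minus_def T.V.a_assoc T.V.l_neg)
      ultimately show ?thesis
        using T.functional_add[OF \<alpha>, of ?\<phi> ?x] less.prems x by simp
    qed
  qed
  then show ?thesis
    using \<alpha> by (intro T.functional_eqI) (auto simp: T.dual_zero_apply)
qed

text \<open>These are the right-hand sides of the diagonal blocks: the values that a functional on
  \<open>\<F> T\<close> prescribes for a functional on the subspace of vanishing trace at \<open>K\<close>.\<close>

lemma functional_along_extension:
  assumes E: "local_extension_operator R \<F> tr K E" and \<alpha>: "\<alpha> \<in> carrier (dual_space R (\<F> T))"
  shows "(\<lambda>\<psi>\<in>carrier (vanishing_trace \<F> tr K). \<alpha> (E \<psi> T)) \<in>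
    carrier (dual_space R (vanishing_trace \<F> tr K))"
proof -
  interpret T: functionals R "\<F> T" by (rule functionals_local)
  interpret K: module R "\<F> K" by (rule vector_space)
  let ?W = "vanishing_trace \<F> tr K"
  have W_add: "\<phi> \<oplus>\<^bsub>\<F> K\<^esub> \<psi> \<in> carrier ?W" if "\<phi> \<in> carrier ?W" "\<psi> \<in> carrier ?W" for \<phi> \<psi>
  proof -
    have "tr K L (\<phi> \<oplus>\<^bsub>\<F> K\<^esub> \<psi>) = \<zero>\<^bsub>\<F> L\<^esub>" if "L < K" for L
    proof -
      interpret L: module R "\<F> L" by (rule vector_space)
      show ?thesis
        using \<open>\<phi> \<in> carrier ?W\<close> \<open>\<psi> \<in> carrier ?W\<close> that tr_linear[of L K]
        by (simp add: vanishing_trace_def linear_maps_def)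
    qed
    then show ?thesis
      using that by (simp add: vanishing_trace_def)
  qed
  have W_smult: "a \<odot>\<^bsub>\<F> K\<^esub> \<psi> \<in> carrier ?W" if "a \<in> carrier R" "\<psi> \<in> carrier ?W" for a \<psi>
  proof -
    have "tr K L (a \<odot>\<^bsub>\<F> K\<^esub> \<psi>) = \<zero>\<^bsub>\<F> L\<^esub>" if "L < K" for L
    proof -
      interpret L: module R "\<F> L" by (rule vector_space)
      show ?thesis
        using \<open>a \<in> carrier R\<close> \<open>\<psi> \<in> carrier ?W\<close> that tr_linear[of L K]
        by (simp add: vanishing_trace_def linear_maps_def)
    qed
    then show ?thesis
      using that by (simp add: vanishing_trace_def)
  qed
  have E_add: "E (\<phi> \<oplus>\<^bsub>?W\<^esub> \<psi>) T = E \<phi> T \<oplus>\<^bsub>\<F> T\<^esub> E \<psi> T"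
    if "\<phi> \<in> carrier ?W" "\<psi> \<in> carrier ?W" for \<phi> \<psi>
    using E that by (simp add: local_extension_operator_def linear_maps_def global_space_def)
  have E_smult: "E (a \<odot>\<^bsub>?W\<^esub> \<psi>) T = a \<odot>\<^bsub>\<F> T\<^esub> E \<psi> T"
    if "a \<in> carrier R" "\<psi> \<in> carrier ?W" for a \<psi>
    using E that by (simp add: local_extension_operator_def linear_maps_def global_space_def)
  have ops: "\<phi> \<oplus>\<^bsub>?W\<^esub> \<psi> = \<phi> \<oplus>\<^bsub>\<F> K\<^esub> \<psi>" "a \<odot>\<^bsub>?W\<^esub> \<psi> = a \<odot>\<^bsub>\<F> K\<^esub> \<psi>" for a \<phi> \<psi>
    by (simp_all add: vanishing_trace_def)
  have "(\<lambda>\<psi>\<in>carrier ?W. \<alpha> (E \<psi> T)) \<in> linear_maps R ?W (field_module R)"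
    unfolding linear_maps_def
    using \<alpha> extension_closed[OF E] E_add E_smult W_add W_smult
    by (auto simp: field_module_def ops T.functional_closed T.functional_add T.functional_smult)
  then show ?thesis
    by (simp add: dual_space_def)
qed

end


section \<open>Decomposition of the dual space\<close>

theorem corollary2p24:
  fixes R :: "('k, 'r) ring_scheme"
    and \<F> :: "'p::{finite, order} \<Rightarrow> ('k, 'v, 'm) module_scheme"
    and tr :: "'p \<Rightarrow> 'p \<Rightarrow> 'v \<Rightarrow> 'v"
    and D :: "'p \<Rightarrow> ('v \<Rightarrow> 'k) set"
    and E :: "'p \<Rightarrow> 'v \<Rightarrow> 'p \<Rightarrow> 'v"
    and T :: 'p
  assumes "function_space R \<F> tr"
    and "\<And>F. restricts_isomorphically R (\<F> F) (vanishing_trace \<F> tr F) (D F)"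
    and "\<And>F. local_extension_operator R \<F> tr F (E F)"
  shows "internal_direct_sum R (dual_space R (\<F> T)) {F. F \<le> T}
    (\<lambda>F. dual_map (\<F> T) (tr T F) ` D F)"
proof -
  interpret function_space R \<F> tr by fact
  interpret T: functionals R "\<F> T" by (rule functionals_local)
  note E = assms(3)
  let ?W = "vanishing_trace \<F> tr"
  have D_sub: "submodule (D F) R (dual_space R (\<F> F))"
    and D_surj: "\<And>\<alpha>. \<alpha> \<in> carrier (dual_space R (?W F)) \<Longrightarrow> \<exists>\<beta>\<in>D F. \<forall>\<psi>\<in>carrier (?W F). \<beta> \<psi> = \<alpha> \<psi>"
    and D_inj: "\<And>\<beta>. \<beta> \<in> D F \<Longrightarrow> \<forall>\<psi>\<in>carrier (?W F). \<beta> \<psi> = \<zero>\<^bsub>R\<^esub> \<Longrightarrow> \<beta> = \<zero>\<^bsub>dual_space R (\<F> F)\<^esub>" for F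
    using assms(2)[of F] by (auto simp: restricts_isomorphically_def)
  define X where "X K = (\<lambda>\<psi>. E K \<psi> T) ` carrier (?W K)" for K
  have pullback: "dual_map (\<F> T) (tr T F) \<beta> (E K \<psi> T) = \<beta> (E K \<psi> F)"
    if "F \<le> T" "\<psi> \<in> carrier (?W K)" for F K \<beta> \<psi>
    using that extension_closed[OF E] tr_extension[OF E] by (simp add: dual_map_apply)
  show ?thesis
  proof (rule T.internal_direct_sum_if_triangular[where X = X])
    show "submodule (dual_map (\<F> T) (tr T F) ` D F) R (dual_space R (\<F> T))"
      if "F \<in> {F. F \<le> T}" for F
    proof (rule linear_image_submodule[OF _ _ _ D_sub])
      show "module R (dual_space R (\<F> F))"
        by (intro module_dual_space vector_space) unfold_locales
      show "dual_map (\<F> T) (tr T F) \<in> linear_maps R (dual_space R (\<F> F)) (dual_space R (\<F> T))"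
        using that by (intro dual_map_linear vector_space tr_linear) (auto intro: field_axioms)
    qed (rule T.dual.module_axioms)
  next
    show "X K \<subseteq> carrier (\<F> T)" for K
      using extension_closed[OF E] by (auto simp: X_def)
  next
    fix F K u x
    assume F: "F \<in> {F. F \<le> T}" and KF: "\<not> K \<le> F"
      and "u \<in> dual_map (\<F> T) (tr T F) ` D F" and "x \<in> X K"
    then obtain \<beta> \<psi> where \<beta>: "\<beta> \<in> D F" "u = dual_map (\<F> T) (tr T F) \<beta>"
      and \<psi>: "\<psi> \<in> carrier (?W K)" "x = E K \<psi> T"
      by (auto simp: X_def)
    interpret F: functionals R "\<F> F" by (rule functionals_local)
    have "\<beta> \<in> carrier (dual_space R (\<F> F))"
      using F.dual.submoduleE(1)[OF D_sub] \<beta>(1) by blast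
    then have "\<beta> (E K \<psi> F) = \<zero>\<^bsub>R\<^esub>"
      by (simp add: extension_eq_zero[OF E \<psi>(1) KF] F.functional_zero)
    then show "u x = \<zero>\<^bsub>R\<^esub>"
      using F \<beta> \<psi> by (simp add: pullback)
  next
    fix K \<alpha>
    assume K: "K \<in> {F. F \<le> T}" and \<alpha>: "\<alpha> \<in> carrier (dual_space R (\<F> T))"
    obtain \<beta> where "\<beta> \<in> D K" "\<And>\<psi>. \<psi> \<in> carrier (?W K) \<Longrightarrow> \<beta> \<psi> = \<alpha> (E K \<psi> T)"
      using D_surj[OF functional_along_extension[OF E \<alpha>], of K] by auto
    then show "\<exists>u\<in>dual_map (\<F> T) (tr T K) ` D K. \<forall>x\<in>X K. u x = \<alpha> x"
      using K by (auto simp: X_def pullback extension_self[OF E])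
  next
    fix K u
    assume K: "K \<in> {F. F \<le> T}" and "u \<in> dual_map (\<F> T) (tr T K) ` D K"
      and vanish: "\<And>x. x \<in> X K \<Longrightarrow> u x = \<zero>\<^bsub>R\<^esub>"
    then obtain \<beta> where \<beta>: "\<beta> \<in> D K" "u = dual_map (\<F> T) (tr T K) \<beta>"
      by blast
    have "\<beta> \<psi> = \<zero>\<^bsub>R\<^esub>" if "\<psi> \<in> carrier (?W K)" for \<psi>
      using vanish[of "E K \<psi> T"] K that pullback[of K \<psi> K \<beta>] \<beta>(2)
      by (simp add: X_def extension_self[OF E])
    then have "\<beta> = \<zero>\<^bsub>dual_space R (\<F> K)\<^esub>"
      using D_inj \<beta>(1) by blast
    then show "u = \<zero>\<^bsub>dual_space R (\<F> T)\<^esub>"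
      using K \<beta>(2) tr_closed[of K T]
      by (auto simp: dual_map_def compose_def dual_space_def intro!: restrict_ext)
  next
    fix \<alpha>
    assume "\<alpha> \<in> carrier (dual_space R (\<F> T))"
      and "\<And>K x. K \<in> {F. F \<le> T} \<Longrightarrow> x \<in> X K \<Longrightarrow> \<alpha> x = \<zero>\<^bsub>R\<^esub>"
    then show "\<alpha> = \<zero>\<^bsub>dual_space R (\<F> T)\<^esub>"
      using E by (intro functional_vanishing_on_extensions[where E = E]) (auto simp: X_def)
  qed simp
qed

end
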